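(* Let $\{\gamma_n\}_{n\ge 1}$ be a sequence of real numbers with $\gamma_1\ge 0$, $\gamma_n>0$ for $n\ge 2$, and $\gamma_1\neq 0$. Let the polynomials $\{\tilde S_n(x)\}_{n\ge 0}$ satisfy $$\tilde S_n(x)=x\tilde S_{n-1}(x)-\tilde\nu_n\tilde S_{n-2}(x),\quad n\ge 1,\qquad \tilde S_{-1}(x)=0,\ \tilde S_0(x)=1,$$ where $\tilde\nu_{2j}=\gamma_{2j-1}$ for $j\ge 1$ and $\tilde\nu_{2j+1}=\gamma_{2j+2}$ for $j\ge 0$. Let $\{\tilde{\mathcal P}_n(x)\}_{n\ge 0}$ be the polynomials determined by $\tilde S_{2n}(x)=\tilde{\mathcal P}_n(x^2)$. Then $$\tilde{\mathcal P}_{n+1}(x)=\bigl(x-(\gamma_{2n+1}+\gamma_{2n+2})\bigr)\tilde{\mathcal P}_n(x)-\gamma_{2n-1}\gamma_{2n+2}\,\tilde{\mathcal P}_{n-1}(x),\quad n\ge 1,$$ with $\tilde{\mathcal P}_0(x)=1$ and $\tilde{\mathcal P}_1(x)=x-\gamma_1$.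
   Context: The polynomials $\tilde S_n$ are symmetric, i.e. $\tilde S_n(-x)=(-1)^n\tilde S_n(x)$, so $\tilde S_{2n}$ is an even polynomial and $\tilde{\mathcal P}_n$ is well defined. (The value of $\tilde\nu_1$ is immaterial because $\tilde S_{-1}=0$.) *)

theory Defs
  imports Complex_Main "HOL-Computational_Algebra.Polynomial"
begin

text \<open>
  The family with \<open>S (-1) = 0\<close> is modelled as \<open>S :: int \<Rightarrow> real poly\<close>; values at indices
  below \<open>-1\<close> are irrelevant. Substitution of \<open>x\<^sup>2\<close> is \<^term>\<open>\<lambda>p :: real poly. pcompose p (monom 1 2)\<close>.
  The next lemma shows that the polynomials \<open>P n\<close> with \<open>S (2n)(x) = P n (x\<^sup>2)\<close> exist and
  are unique, so that a hypothesis characterising them this way is always satisfiable.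
\<close>

lemma even_index_polys_well_defined:
  fixes \<nu> :: "nat \<Rightarrow> real" and S :: "int \<Rightarrow> real poly"
  assumes Sm1: "S (-1) = 0" and S0: "S 0 = 1"
    and Srec: "\<And>n::nat. n \<ge> 1 \<Longrightarrow>
      S (int n) = [:0, 1:] * S (int n - 1) - smult (\<nu> n) (S (int n - 2))"
  shows "\<exists>!P :: nat \<Rightarrow> real poly. \<forall>n. S (2 * int n) = pcompose (P n) (monom 1 2)"
proof -
  let ?q = "monom 1 2 :: real poly"
  have q: "?q = [:0, 1:] * [:0, 1:]"
    by (simp add: numeral_2_eq_2 monom_Suc monom_0)
  have ex: "\<exists>p r. S (2 * int n) = pcompose p ?q \<and> S (2 * int n - 1) = [:0, 1:] * pcompose r ?q" for n
  proof (induction n)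
    case 0
    show ?case
      by (intro exI[of _ "1"] exI[of _ "0"]) (simp add: Sm1 S0 pcompose_1)
  next
    case (Suc n)
    then obtain p r where p: "S (2 * int n) = pcompose p ?q"
      and r: "S (2 * int n - 1) = [:0, 1:] * pcompose r ?q" by blast
    have odd_rec: "S (2 * int n + 1) = [:0, 1:] * S (2 * int n) - smult (\<nu> (2*n+1)) (S (2 * int n - 1))"
      using Srec[of "2*n+1"] by (simp add: algebra_simps)
    have odd: "S (2 * int n + 1) = [:0, 1:] * pcompose (p - smult (\<nu> (2*n+1)) r) ?q"
      unfolding odd_rec p r pcompose_diff pcompose_smult by (simp add: algebra_simps)
    have even_rec: "S (2 * int n + 2) = [:0, 1:] * S (2 * int n + 1) - smult (\<nu> (2*n+2)) (S (2 * int n))"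
      using Srec[of "2*n+2"] by (simp add: algebra_simps)
    have "S (2 * int n + 2)
        = pcompose ([:0, 1:] * (p - smult (\<nu> (2*n+1)) r) - smult (\<nu> (2*n+2)) p) ?q"
      unfolding even_rec odd p pcompose_diff pcompose_smult pcompose_mult
      by (simp add: pcompose_pCons q mult.assoc)
    with odd show ?case by (force simp: algebra_simps)
  qed
  then obtain P where P: "\<And>n. S (2 * int n) = pcompose (P n) ?q" by metis
  have inj: "p = p'" if "pcompose p ?q = pcompose p' ?q" for p p' :: "real poly"
  proof -
    have "pcompose (p - p') ?q = 0" using that by (simp add: pcompose_diff)
    then have "p - p' = 0"
      by (rule pcompose_eq_0) (simp add: degree_monom_eq)
    then show ?thesis by simp
  qed
  show ?thesis
  proof (rule ex1I[of _ P])
    show "\<forall>n. S (2 * int n) = pcompose (P n) ?q" using P by blast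
    show "Q = P" if "\<forall>n. S (2 * int n) = pcompose (Q n) ?q" for Q
      using that P inj by (metis ext)
  qed
qed

end

theory Submission
  imports Defs
begin

text \<open>Three consecutive instances of the recurrence link \<open>S (2n-2)\<close>, ...,
  \<open>S (2n+2)\<close>; eliminating the two odd-indexed members leaves a three-term recurrence in
  which x occurs only as x^2 (\<open>three_term_recurrence_step_two\<close>). Both sides are then
  images under x -> x^2, a substitution that can be cancelled
  (\<open>pcompose_X2_inject\<close>).\<close>

text \<open>Substitution is additive, and over an integral domain a nonconstant inner polynomial
  sends only 0 to 0.\<close>

lemma pcompose_X2_inject:
  fixes p q :: "'a::idom poly"
  assumes "pcompose p (monom 1 2) = pcompose q (monom 1 2)"
  shows "p = q"
proof -
  have "pcompose (p - q) (monom 1 2) = 0"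
    using assms by (simp add: pcompose_diff)
  then have "p - q = 0"
    by (rule pcompose_eq_0) (simp add: degree_monom_eq)
  then show ?thesis by simp
qed

lemma pcompose_linear_X2:
  fixes c :: "'a::comm_ring_1"
  shows "pcompose [:- c, 1:] (monom 1 2) = [:0, 1:] * [:0, 1:] - [:c:]"
  by (simp add: pcompose_pCons numeral_2_eq_2 monom_Suc monom_0)

lemma three_term_recurrence_step_two:
  fixes a b c d e :: "'a::comm_ring_1 poly"
  assumes "c = [:0, 1:] * b - smult u a"
    and "d = [:0, 1:] * c - smult v b"
    and "e = [:0, 1:] * d - smult w c"
  shows "e = ([:0, 1:] * [:0, 1:] - [:v + w:]) * c - smult (u * v) a"
proof -
  \<comment> \<open>Once \<open>d\<close> is expanded, \<open>b\<close> enters \<open>e\<close> only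
    through x*b, so the first relation eliminates it without dividing by x.\<close>
  have "[:0, 1:] * b = c + smult u a"
    using assms(1) by simp
  moreover have "e = [:0, 1:] * ([:0, 1:] * c) - smult v ([:0, 1:] * b) - smult w c"
    unfolding assms(2,3) by (simp only: right_diff_distrib mult_smult_right)
  ultimately have "e = [:0, 1:] * ([:0, 1:] * c) - smult v (c + smult u a) - smult w c"
    by simp
  also have "\<dots> = ([:0, 1:] * [:0, 1:] - [:v + w:]) * c - smult (u * v) a"
    by (simp add: left_diff_distrib smult_add_right smult_diff_left mult.commute)
  finally show ?thesis .
qed

theorem theorem3p1:
  fixes \<gamma> \<nu> :: "nat \<Rightarrow> real"
    and S :: "int \<Rightarrow> real poly"
    and P :: "nat \<Rightarrow> real poly"
  assumes "\<gamma> 1 \<ge> 0" and "\<And>n. n \<ge> 2 \<Longrightarrow> \<gamma> n > 0" and "\<gamma> 1 \<noteq> 0"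
    and nu_even: "\<And>j. j \<ge> 1 \<Longrightarrow> \<nu> (2 * j) = \<gamma> (2 * j - 1)"
    and nu_odd: "\<And>j. \<nu> (2 * j + 1) = \<gamma> (2 * j + 2)"
    and S_neg1: "S (-1) = 0" and S_0: "S 0 = 1"
    and S_rec: "\<And>n::nat. n \<ge> 1 \<Longrightarrow>
      S (int n) = [:0, 1:] * S (int n - 1) - smult (\<nu> n) (S (int n - 2))"
    and P_def: "\<And>n. S (2 * int n) = pcompose (P n) (monom 1 2)"
  shows "(\<forall>n\<ge>1. P (n + 1) = [:- (\<gamma> (2 * n + 1) + \<gamma> (2 * n + 2)), 1:] * P n
            - smult (\<gamma> (2 * n - 1) * \<gamma> (2 * n + 2)) (P (n - 1)))
    \<and> P 0 = 1 \<and> P 1 = [:- \<gamma> 1, 1:]"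
proof (intro conjI allI impI)
  show "P 0 = 1"
    using P_def[of 0] S_0 by - (rule pcompose_X2_inject, simp add: pcompose_1)
next
  \<comment> \<open>The \<open>\<nu> 1\<close> term carries the factor \<open>S (-1) = 0\<close>;
    hence \<open>P 1\<close> subtracts \<open>\<gamma> 1\<close> alone rather than a sum of two
    coefficients.\<close>
  have "S 1 = [:0, 1:]"
    using S_rec[of 1] S_0 S_neg1 by simp
  moreover have "S 2 = [:0, 1:] * S 1 - smult (\<gamma> 1) (S 0)"
    using S_rec[of 2] nu_even[of 1] by simp
  ultimately have "S 2 = [:0, 1:] * [:0, 1:] - [:\<gamma> 1:]"
    using S_0 by (simp add: one_pCons)
  then show "P 1 = [:- \<gamma> 1, 1:]"
    using P_def[of 1] by - (rule pcompose_X2_inject, simp only: pcompose_linear_X2 of_nat_1 mult_1_right)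
next
  fix n :: nat assume n: "n \<ge> 1"
  \<comment> \<open>\<open>n \<ge> 1\<close> makes \<open>2 * int (n - 1)\<close> equal to 2n-2
    despite truncated subtraction.\<close>
  have s0: "S (2 * int n) = [:0, 1:] * S (2 * int n - 1)
      - smult (\<gamma> (2 * n - 1)) (S (2 * int (n - 1)))"
    using S_rec[of "2 * n"] nu_even[of n] n by (simp add: of_nat_diff algebra_simps)
  have s1: "S (2 * int n + 1) = [:0, 1:] * S (2 * int n)
      - smult (\<gamma> (2 * n + 2)) (S (2 * int n - 1))"
    using S_rec[of "2 * n + 1"] nu_odd[of n] by (simp add: algebra_simps)
  have s2: "S (2 * int (n + 1)) = [:0, 1:] * S (2 * int n + 1)
      - smult (\<gamma> (2 * n + 1)) (S (2 * int n))"
    using S_rec[of "2 * n + 2"] nu_even[of "n + 1"] by (simp add: algebra_simps)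
  show "P (n + 1) = [:- (\<gamma> (2 * n + 1) + \<gamma> (2 * n + 2)), 1:] * P n
      - smult (\<gamma> (2 * n - 1) * \<gamma> (2 * n + 2)) (P (n - 1))"
    \<comment> \<open>Here u, v, w are \<open>\<nu>\<close> at 2n, 2n+1, 2n+2, so v + w and u * v
      give the two coefficients.\<close>
    using three_term_recurrence_step_two[OF s0 s1 s2]
    by - (rule pcompose_X2_inject,
      simp only: pcompose_diff pcompose_mult pcompose_smult pcompose_linear_X2 P_def add.commute)
qed

end
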